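(* Let $N$ be a positive integer whose trajectory under the Collatz function reaches $1$, and let $t$ be the base of $N$. Then every complex root $\xi$ of the Collatz polynomial $P_N$ satisfies $$|\xi|\leq h(t):=\frac{2}{r_{t+3}}\cdot\left(\frac{75}{32}+2^{-(t+2)}\right)^{\frac{1}{t+2}},$$ where $r_{t+3}$ is the unique root of $x^{t+2}+x-1$ contained in the interval $\left[\frac12,1\right)$. Moreover, $h(t)$ decreases monotonically to $2$ as $t\to\infty$.
   Context: The Collatz function is $c(N)=\frac{3N+1}{2}$ for $N$ odd and $c(N)=\frac N2$ for $N$ even. Let $N$ be a positive integer whose trajectory $N, c(N), c(c(N)),\dots$ reaches $1$. The total stopping time $n$ of $N$ is the least $k\ge 0$ such that the $k$-th iterate of $N$ under $c$ equals $1$. Set $c^0(N)=N$, $c^k(N)=c(c^{k-1}(N))$ for $1\le k\le n$, and $c^k(N)=0$ for $k>n$. The $N$-th Collatz polynomial is $P_N(z)=\sum_{k=0}^{n}c^k(N)z^k$ (monic of degree $n$ with constant term $N$). The base $t$ of $N$ is the logarithm to base $2$ of the first term in the sequence $c^0(N)=N, c^1(N), c^2(N),\dots$ that is a power of two (where $1=2^0$ counts as a power of two). For an integer $m\geq 2$, $r_m$ denotes the unique root of $x^{m-1}+x-1$ in $[\frac12,1)$. *)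

theory Defs
  imports
    "HOL-Analysis.Analysis"
    "HOL-Computational_Algebra.Polynomial"
begin

definition collatz :: "nat \<Rightarrow> nat" where
  "collatz N = (if odd N then (3 * N + 1) div 2 else N div 2)"

definition reaches_one :: "nat \<Rightarrow> bool" where
  "reaches_one N \<longleftrightarrow> (\<exists>k. (collatz ^^ k) N = 1)"

text \<open>The functions \<open>total_stopping_time\<close>, \<open>collatz_seq\<close>, \<open>collatz_poly\<close> and
  \<open>collatz_base\<close> are only meaningful for \<open>N\<close> with \<^term>\<open>reaches_one N\<close>.\<close>

definition total_stopping_time :: "nat \<Rightarrow> nat" where
  "total_stopping_time N = (LEAST k. (collatz ^^ k) N = 1)"

definition collatz_seq :: "nat \<Rightarrow> nat \<Rightarrow> nat" where
  "collatz_seq N k = (if k \<le> total_stopping_time N then (collatz ^^ k) N else 0)"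

definition collatz_poly :: "nat \<Rightarrow> complex poly" where
  "collatz_poly N = (\<Sum>k\<le>total_stopping_time N. monom (of_nat (collatz_seq N k)) k)"

definition collatz_base :: "nat \<Rightarrow> nat" where
  "collatz_base N =
     (THE t. collatz_seq N (LEAST k. \<exists>j. collatz_seq N k = 2 ^ j) = 2 ^ t)"

definition trinomial_root :: "nat \<Rightarrow> real" where
  "trinomial_root m = (THE x. x \<in> {1/2..<1} \<and> x ^ (m - 1) + x - 1 = 0)"

lemma trinomial_root_ex1:
  assumes "m \<ge> 2"
  shows "\<exists>!x::real. x \<in> {1/2..<1} \<and> x ^ (m - 1) + x - 1 = 0"
proof -
  define n where "n = m - 1"
  have n: "n \<ge> 1" using assms by (simp add: n_def)
  have le: "(1/2::real) ^ n + 1/2 - 1 \<le> 0"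
    using power_decreasing[of 1 n "1/2::real"] n by simp
  have "\<exists>x\<ge>1/2. x \<le> 1 \<and> x ^ n + x - 1 = (0::real)"
    by (rule IVT') (use le in \<open>auto intro!: continuous_intros\<close>)
  then obtain x :: real where x: "1/2 \<le> x" "x \<le> 1" "x ^ n + x - 1 = 0"
    by blast
  have "x \<noteq> 1" using x(3) by auto
  with x have "x \<in> {1/2..<1} \<and> x ^ n + x - 1 = 0" by auto
  moreover have "y = z"
    if "y \<in> {1/2..<1} \<and> y ^ n + y - 1 = 0" "z \<in> {1/2..<1} \<and> z ^ n + z - 1 = 0"
    for y z :: real
    using that power_mono[of y z n] power_mono[of z y n] by (cases "y \<le> z") auto
  ultimately show ?thesis unfolding n_def[symmetric] by blast
qed

definition root_bound :: "nat \<Rightarrow> real" where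
  "root_bound t = 2 / trinomial_root (t + 3)
     * (75 / 32 + 2 powr (- real (t + 2))) powr (1 / real (t + 2))"

end

theory Submission
  imports Defs "HOL-Real_Asymp.Real_Asymp"
begin

text \<open>
  Every step of the Collatz function at most halves its argument, so consecutive coefficients
  of the Collatz polynomial satisfy \<open>c\<^sub>k \<le> 2 c\<^sub>k\<^sub>+\<^sub>1\<close>. By the Enestroem--Kakeya theorem
  (\<open>Enestroem_Kakeya\<close>) all its roots therefore lie in the disc of radius \<open>2\<close>, whatever
  the base of \<open>N\<close> is. Both factors multiplying \<open>2\<close> in \<^const>\<open>root_bound\<close> exceed \<open>1\<close>, so the
  radius \<open>2\<close> is below the bound claimed.

  The same two factors give the monotonicity: increasing the exponent lowers \<open>x ^ k + x\<close> on
  \<open>(0, 1)\<close>, which pushes the root of \<open>x ^ k + x = 1\<close> to the right, while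
  \<open>(75/32 + 2\<^sup>-\<^sup>k) powr (1/k)\<close> has a decreasing base above \<open>1\<close> and a decreasing exponent.
  Both factors tend to \<open>1\<close>, for the trinomial root because \<open>e ^ k + e < 1\<close> holds eventually
  for each \<open>e\<close> in \<open>(0, 1)\<close>.
\<close>

text \<open>The differences on the right-hand side are nonnegative under the hypothesis of the
  Enestroem--Kakeya theorem. The identity is stated over a commutative ring because it is applied
  both at a complex root and at its real modulus.\<close>

lemma linear_factor_times_sum:
  fixes x \<rho> :: "'a::comm_ring_1"
  shows "(x - \<rho>) * (\<Sum>k\<le>n. c k * x ^ k)
           = c n * x ^ Suc n - ((\<Sum>k<n. (\<rho> * c (Suc k) - c k) * x ^ Suc k) + \<rho> * c 0)"
  by (induction n) (simp_all add: algebra_simps)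

text \<open>At a root \<open>z\<close> the leading term of the product with \<open>z - \<rho>\<close> equals the sum whose
  coefficients are the nonnegative differences and \<open>\<rho> c\<^sub>0\<close>. If \<open>R = |z|\<close> exceeded \<open>\<rho>\<close>,
  the triangle inequality would bound that sum by its value at \<open>R\<close>, which falls short of \<open>c\<^sub>n R\<^sup>n\<^sup>+\<^sup>1\<close> by
  \<open>(R - \<rho>) \<Sum> c\<^sub>k R\<^sup>k > 0\<close>.\<close>

lemma Enestroem_Kakeya:
  fixes c :: "nat \<Rightarrow> real" and z :: complex
  assumes nonneg: "\<And>k. k \<le> n \<Longrightarrow> 0 \<le> c k" and lead: "0 < c n"
    and ratio: "\<And>k. k < n \<Longrightarrow> c k \<le> \<rho> * c (Suc k)" and "0 \<le> \<rho>"
    and root: "(\<Sum>k\<le>n. of_real (c k) * z ^ k) = 0"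
  shows "cmod z \<le> \<rho>"
proof (rule ccontr)
  assume "\<not> cmod z \<le> \<rho>"
  define R where "R = cmod z"
  have R: "\<rho> < R" "0 < R"
    using \<open>\<not> cmod z \<le> \<rho>\<close> \<open>0 \<le> \<rho>\<close> by (auto simp: R_def)
  let ?d = "\<lambda>k. \<rho> * c (Suc k) - c k"
  have "of_real (c n) * z ^ Suc n
          = (\<Sum>k<n. of_real (?d k) * z ^ Suc k) + of_real (\<rho> * c 0)"
    using linear_factor_times_sum[of z "of_real \<rho>" "\<lambda>k. of_real (c k)" n] root by simp
  then have "c n * R ^ Suc n = cmod ((\<Sum>k<n. of_real (?d k) * z ^ Suc k) + of_real (\<rho> * c 0))"
    using lead by (metis R_def abs_of_pos norm_mult norm_of_real norm_power)
  also have "\<dots> \<le> (\<Sum>k<n. cmod (of_real (?d k) * z ^ Suc k)) + cmod (of_real (\<rho> * c 0))"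
    by (intro norm_triangle_mono norm_sum order_refl)
  also have "\<dots> = (\<Sum>k<n. ?d k * R ^ Suc k) + \<rho> * c 0"
    using nonneg[of 0] ratio \<open>0 \<le> \<rho>\<close>
    by (intro arg_cong2[where f = "(+)"] sum.cong)
       (simp_all add: norm_mult norm_power R_def del: of_real_diff of_real_mult power_Suc)
  also have "\<dots> = c n * R ^ Suc n - (R - \<rho>) * (\<Sum>k\<le>n. c k * R ^ k)"
    using linear_factor_times_sum[of R \<rho> c n] by simp
  also have "\<dots> < c n * R ^ Suc n"
  proof -
    have "0 < c n * R ^ n"
      using lead R by simp
    also have "\<dots> \<le> (\<Sum>k\<le>n. c k * R ^ k)"
      using nonneg R by (intro member_le_sum) auto
    finally show ?thesis
      using R by simp
  qed
  finally show False
    by simp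
qed

lemma le_double_collatz: "m \<le> 2 * collatz m"
  by (auto simp: collatz_def elim!: oddE)

lemma collatz_poly_root_le_2:
  assumes "reaches_one N" and root: "poly (collatz_poly N) \<xi> = 0"
  shows "cmod \<xi> \<le> 2"
proof (rule Enestroem_Kakeya[where n = "total_stopping_time N"
      and c = "\<lambda>k. real (collatz_seq N k)"])
  let ?n = "total_stopping_time N"
  have "(collatz ^^ ?n) N = 1"
    using assms(1) unfolding reaches_one_def total_stopping_time_def by (rule LeastI_ex)
  then show "0 < real (collatz_seq N ?n)"
    by (simp add: collatz_seq_def)
  show "real (collatz_seq N k) \<le> 2 * real (collatz_seq N (Suc k))" if "k < ?n" for k
    using that le_double_collatz[of "(collatz ^^ k) N"] by (simp add: collatz_seq_def)
  show "(\<Sum>k\<le>?n. of_real (real (collatz_seq N k)) * \<xi> ^ k) = 0"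
    using root by (simp add: collatz_poly_def poly_sum poly_monom)
qed simp_all

lemma trinomial_root:
  shows trinomial_root_ge: "1 / 2 \<le> trinomial_root (t + 3)"
    and trinomial_root_less_1: "trinomial_root (t + 3) < 1"
    and trinomial_root_eq: "trinomial_root (t + 3) ^ (t + 2) + trinomial_root (t + 3) = 1"
  using theI'[OF trinomial_root_ex1[of "t + 3"]] unfolding trinomial_root_def by auto

text \<open>The function \<open>x ^ (t + 2) + x\<close> is increasing for \<open>x \<ge> 0\<close> and takes the value \<open>1\<close> at the
  trinomial root.\<close>

lemma less_trinomial_rootI:
  fixes e :: real
  assumes "e ^ (t + 2) + e < 1"
  shows "e < trinomial_root (t + 3)"
proof (rule ccontr)
  assume "\<not> e < trinomial_root (t + 3)"
  then have "trinomial_root (t + 3) ^ (t + 2) \<le> e ^ (t + 2)"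
    using trinomial_root_ge[of t] by (intro power_mono) auto
  with assms trinomial_root_eq[of t] \<open>\<not> e < trinomial_root (t + 3)\<close> show False
    by linarith
qed

lemma trinomial_root_strict_mono:
  assumes "s < t"
  shows "trinomial_root (s + 3) < trinomial_root (t + 3)"
proof (rule less_trinomial_rootI)
  have "trinomial_root (s + 3) ^ (t + 2) < trinomial_root (s + 3) ^ (s + 2)"
    using assms trinomial_root_ge[of s] trinomial_root_less_1[of s]
    by (intro power_strict_decreasing) auto
  then show "trinomial_root (s + 3) ^ (t + 2) + trinomial_root (s + 3) < 1"
    using trinomial_root_eq[of s] by linarith
qed

lemma trinomial_root_tendsto_1: "(\<lambda>t. trinomial_root (t + 3)) \<longlonglongrightarrow> 1"
proof (rule order_tendstoI)
  fix a :: real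
  assume "a < 1"
  define e where "e = max a (1 / 2)"
  have e: "0 < e" "e < 1" "a \<le> e"
    using \<open>a < 1\<close> by (auto simp: e_def)
  have "(\<lambda>t. e ^ (t + 2)) \<longlonglongrightarrow> 0"
    using e by (intro LIMSEQ_ignore_initial_segment LIMSEQ_power_zero) auto
  then have "\<forall>\<^sub>F t in sequentially. e ^ (t + 2) < 1 - e"
    by (rule order_tendstoD) (use e in simp)
  then show "\<forall>\<^sub>F t in sequentially. a < trinomial_root (t + 3)"
  proof eventually_elim
    case (elim t)
    then have "e < trinomial_root (t + 3)"
      by (intro less_trinomial_rootI) simp
    with e show ?case
      by simp
  qed
next
  fix a :: real
  assume "1 < a"
  then show "\<forall>\<^sub>F t in sequentially. trinomial_root (t + 3) < a"
    by (intro always_eventually allI less_trans[OF trinomial_root_less_1])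
qed

lemma radicand_greater_1: "1 < 75 / 32 + 2 powr (- real (t + 2))"
  using powr_gt_zero[of 2 "- real (t + 2)"] by linarith

lemma root_bound_greater_2: "2 < root_bound t"
proof -
  have "2 < 2 / trinomial_root (t + 3)"
    using trinomial_root_ge[of t] trinomial_root_less_1[of t] by (simp add: field_simps)
  moreover have "1 < (75 / 32 + 2 powr (- real (t + 2))) powr (1 / real (t + 2))"
    by (intro gr_one_powr radicand_greater_1) simp
  ultimately have "2 * 1 < root_bound t"
    unfolding root_bound_def using trinomial_root_ge[of t] by (intro mult_strict_mono) auto
  then show ?thesis
    by simp
qed

lemma root_bound_strict_antimono:
  assumes "s < t"
  shows "root_bound t < root_bound s"
proof -
  let ?b = "\<lambda>t. 75 / 32 + 2 powr (- real (t + 2)) :: real"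
  have "2 / trinomial_root (t + 3) < 2 / trinomial_root (s + 3)"
    using trinomial_root_strict_mono[OF assms] trinomial_root_ge[of s]
    by (intro divide_strict_left_mono) auto
  moreover have "?b t powr (1 / real (t + 2)) \<le> ?b s powr (1 / real (s + 2))"
  proof -
    have "?b t powr (1 / real (t + 2)) \<le> ?b s powr (1 / real (t + 2))"
      using assms radicand_greater_1[of t] by (intro powr_mono2) auto
    also have "\<dots> \<le> ?b s powr (1 / real (s + 2))"
      using assms radicand_greater_1[of s] by (intro powr_mono) (auto simp: field_simps)
    finally show ?thesis .
  qed
  moreover have "0 < ?b t powr (1 / real (t + 2))"
    using radicand_greater_1[of t] by simp
  ultimately show ?thesis
    unfolding root_bound_def using trinomial_root_ge[of t]
    by (intro mult_less_le_imp_less) auto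
qed

lemma root_bound_tendsto_2: "root_bound \<longlonglongrightarrow> 2"
proof -
  have "(\<lambda>t. (75 / 32 + 2 powr (- real (t + 2))) powr (1 / real (t + 2))) \<longlonglongrightarrow> 1"
    by real_asymp
  then have "root_bound \<longlonglongrightarrow> 2 / 1 * 1"
    unfolding root_bound_def by (intro tendsto_intros trinomial_root_tendsto_1) auto
  then show ?thesis
    by simp
qed

theorem mainTheorem1:
  shows "(\<forall>N::nat. N > 0 \<longrightarrow> reaches_one N \<longrightarrow>
            (\<forall>\<xi>::complex. poly (collatz_poly N) \<xi> = 0 \<longrightarrow>
               cmod \<xi> \<le> root_bound (collatz_base N)))
       \<and> (\<forall>s t::nat. s < t \<longrightarrow> root_bound t < root_bound s)
       \<and> root_bound \<longlonglongrightarrow> 2"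
  using collatz_poly_root_le_2 root_bound_greater_2 root_bound_strict_antimono
    root_bound_tendsto_2
  by (meson less_imp_le order_trans)

end
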